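(* Let $1\leq m\leq d$ be integers, let $\{e_1,\ldots,e_m\}\subset\mathbb{R}^d$ be a linearly independent set of $m$ vectors, and let $$\ell(\{e_1,\ldots,e_m\})=\min_{\omega\in\{0,1\}^m\setminus\{0\}^m}\|\omega_1e_1+\cdots+\omega_me_m\|,$$ where $\omega=(\omega_1,\ldots,\omega_m)$. Let $\varepsilon\in[0,1)$ satisfy $0\leq\varepsilon<\ell(\{e_1,\ldots,e_m\})/2$. If $F\subseteq\mathbb{R}^d$ contains $(k,\varepsilon,\{e_1,\ldots,e_m\})$-APs for all integers $k\geq3$ (i.e. for every integer $k\geq 3$ there is a $(k,\varepsilon,\{e_1,\ldots,e_m\})$-AP $Q$ with $Q\subseteq F$), then $\dim_{\mathrm{A}}F\geq m$.
   Context: $\|\cdot\|$ is the Euclidean norm on $\mathbb{R}^d$. Arithmetic patches. Let $1\leq m\leq d$ be integers and let $\{e_1,\ldots,e_m\}$ be a set of linearly independent vectors in $\mathbb{R}^d$. For $k\in\mathbb{N}$ and $\Delta>0$, a set $P\subset\mathbb{R}^d$ is an arithmetic patch of size $k$ and scale $\Delta$ with respect to orientation $\{e_1,\ldots,e_m\}$ if $$P=\left\{t+\Delta\sum_{i=1}^m x_ie_i \colon x_i=0,1,\ldots,k-1\right\}$$ for some $t\in\mathbb{R}^d$. For $\varepsilon\in[0,1)$, a set $Q\subset\mathbb{R}^d$ is a $(k,\varepsilon,\{e_1,\ldots,e_m\})$-AP if there exists an arithmetic patch $P$ of size $k$ and some scale $\Delta>0$ with respect to orientation $\{e_1,\ldots,e_m\}$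 such that $\#Q=\#P$ and $\inf_{y\in Q}\|x-y\|\leq\varepsilon\Delta$ for all $x\in P$. Assouad dimension. For bounded $E\subset\mathbb{R}^d$ and $r>0$, $N(E,r)$ is the smallest number of open sets with diameter at most $r$ required to cover $E$. For $F\subseteq\mathbb{R}^d$, $\dim_{\mathrm{A}}F$ is the infimum of all $\sigma\geq0$ for which there exists $C>0$ such that for all $R>0$, all $r\in(0,R)$ and all $x\in F$, $$N\big(B(x,R)\cap F,r\big)\leq C\left(\frac{R}{r}\right)^{\sigma},$$ where $B(x,R)$ is the closed ball with centre $x$ and radius $R$. *)

theory Defs
  imports "HOL-Analysis.Analysis"
begin

(* An orientation is a finite set E of vectors, so coordinates (x_1, ..., x_m) are
   functions on E rather than on {1..m}. *)

definition arithmetic_patch ::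
    "(real ^ 'd) set \<Rightarrow> nat \<Rightarrow> real \<Rightarrow> (real ^ 'd) set \<Rightarrow> bool" where
  "arithmetic_patch E k \<Delta> P \<longleftrightarrow>
     (\<exists>t. P = {t + \<Delta> *\<^sub>R (\<Sum>e\<in>E. real (x e) *\<^sub>R e) | x :: real ^ 'd \<Rightarrow> nat. \<forall>e\<in>E. x e \<in> {0..<k}})"

definition approx_AP ::
    "nat \<Rightarrow> real \<Rightarrow> (real ^ 'd) set \<Rightarrow> (real ^ 'd) set \<Rightarrow> bool" where
  "approx_AP k \<epsilon> E Q \<longleftrightarrow>
     (\<exists>P \<Delta>. \<Delta> > 0 \<and> arithmetic_patch E k \<Delta> P \<and> finite Q \<and> card Q = card P \<and>
       (\<forall>x\<in>P. (INF y\<in>Q. norm (x - y)) \<le> \<epsilon> * \<Delta>))"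

definition min_subset_sum_norm :: "(real ^ 'd) set \<Rightarrow> real" where
  "min_subset_sum_norm E =
     Min ((\<lambda>\<omega>. norm (\<Sum>e\<in>E. \<omega> e *\<^sub>R e)) ` ((E \<rightarrow>\<^sub>E {0, 1}) - {\<lambda>e\<in>E. 0}))"

(* Boundedness of U is explicit because the library's diameter is meaningless on
   unbounded sets. *)
definition covering_number :: "(real ^ 'd) set \<Rightarrow> real \<Rightarrow> nat" where
  "covering_number S r =
     (LEAST n. \<exists>\<U>. finite \<U> \<and> card \<U> = n \<and> S \<subseteq> \<Union>\<U> \<and>
        (\<forall>U\<in>\<U>. open U \<and> bounded U \<and> diameter U \<le> r))"

definition assouad_dim :: "(real ^ 'd) set \<Rightarrow> ereal" where
  "assouad_dim F =
     Inf {ereal \<sigma> | \<sigma>. \<sigma> \<ge> 0 \<and>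
       (\<exists>C>0. \<forall>R>0. \<forall>r\<in>{0<..<R}. \<forall>x\<in>F.
          real (covering_number (cball x R \<inter> F) r) \<le> C * (R / r) powr \<sigma>)}"

end

theory Submission
  imports Defs
begin

text \<open>
  Write \<open>\<Lambda> x = \<Sum>e\<in>E. x e \<cdot> e\<close> for integer coordinates \<open>x\<close>. An approximate progression of size \<open>k\<close> and
  scale \<open>\<Delta>\<close> inside \<open>F\<close> supplies, for each of the \<open>k ^ m\<close> coordinate vectors \<open>x\<close>, a point
  \<open>y x \<in> F\<close> within \<open>\<epsilon> \<Delta> < \<Delta>\<close> of \<open>t + \<Delta> \<cdot> \<Lambda> x\<close>. All of these points lie in one ball whose radius \<open>R\<close> is
  \<open>\<Delta>\<close> times a constant times \<open>k\<close>, and it is natural to cover that ball at the scale \<open>r = \<Delta>\<close>.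

  The map \<open>y\<close> may fail to be injective, since differences such as \<open>e - e'\<close> may be very
  short, but it has bounded multiplicity at the scale \<open>\<Delta>\<close>: if \<open>y x\<close> and \<open>y x'\<close> are at distance at most
  \<open>\<Delta>\<close>, then \<open>\<Lambda> x\<close> and \<open>\<Lambda> x'\<close> are at distance at most \<open>3\<close>, and because \<open>E\<close> is
  independent its coordinates are Lipschitz functions of the vector
  (\<open>coordinates_bounded_by_norm\<close>), so \<open>x\<close> and \<open>x'\<close> differ by at most a constant \<open>K\<close> in every
  coordinate. Hence a set of diameter at most \<open>\<Delta>\<close> serves at most \<open>(2 K + 1) ^ m\<close> of
  the coordinate vectors, and a cover needs at least \<open>k ^ m / (2 K + 1) ^ m\<close> sets
  (\<open>covering_number_of_approx_AP\<close>).

  The ratio \<open>R / r\<close> is proportional to \<open>k\<close>, so an exponent \<open>\<sigma>\<close> admissible for the Assouad dimension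
  gives \<open>k ^ m \<le> const \<cdot> k ^ \<sigma>\<close> for all \<open>k \<ge> 3\<close>, which forces \<open>\<sigma> \<ge> m\<close>.
\<close>

section \<open>Coordinates with respect to an independent set\<close>

text \<open>The coordinate functional dual to a member of \<open>E\<close> extends to a linear functional on the whole
  space, and linear functionals in finite dimension are bounded.\<close>

lemma coordinates_bounded_by_norm:
  fixes E :: "'a::euclidean_space set"
  assumes "independent E"
  obtains B where "B > 0"
    and "\<And>a e. e \<in> E \<Longrightarrow> \<bar>a e\<bar> \<le> B * norm (\<Sum>v\<in>E. a v *\<^sub>R v)"
proof -
  have fin: "finite E"
    using assms independent_imp_finite by blast
  have "\<exists>b>0. \<forall>a. \<bar>a e\<bar> \<le> b * norm (\<Sum>v\<in>E. a v *\<^sub>R v)" if e: "e \<in> E" for e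
  proof -
    obtain g :: "'a \<Rightarrow> real"
      where g: "linear g" and dual: "\<forall>v\<in>E. g v = (if v = e then 1 else 0)"
      using linear_independent_extend[OF assms, of "\<lambda>v. if v = e then 1 else 0"] by blast
    have coord: "g (\<Sum>v\<in>E. a v *\<^sub>R v) = a e" for a
    proof -
      have "g (\<Sum>v\<in>E. a v *\<^sub>R v) = (\<Sum>v\<in>E. a v * g v)"
        using g by (simp add: linear_sum linear_scale)
      also have "\<dots> = (\<Sum>v\<in>E. if v = e then a v else 0)"
        using dual by (intro sum.cong) auto
      finally show ?thesis
        using fin e by simp
    qed
    obtain b where "b > 0" and b: "\<And>v. norm (g v) \<le> b * norm v"
      using linear_bounded_pos[OF g] by blast
    have "\<bar>a e\<bar> \<le> b * norm (\<Sum>v\<in>E. a v *\<^sub>R v)" for a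
      using b[of "\<Sum>v\<in>E. a v *\<^sub>R v"] by (simp only: coord real_norm_def)
    with \<open>b > 0\<close> show ?thesis
      by blast
  qed
  then have "\<forall>e\<in>E. \<exists>b>0. \<forall>a. \<bar>a e\<bar> \<le> b * norm (\<Sum>v\<in>E. a v *\<^sub>R v)"
    by blast
  from bchoice[OF this] obtain b where b_pos: "\<And>e. e \<in> E \<Longrightarrow> b e > 0"
    and b: "\<And>e a. e \<in> E \<Longrightarrow> \<bar>a e\<bar> \<le> b e * norm (\<Sum>v\<in>E. a v *\<^sub>R v)"
    by blast
  show thesis
  proof
    show "1 + sum b E > 0"
      using b_pos by (intro add_pos_nonneg sum_nonneg) (auto intro: less_imp_le)
    fix a e assume e: "e \<in> E"
    have "b e \<le> 1 + sum b E"
      using member_le_sum[of e E b] e fin b_pos by (force intro: less_imp_le)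
    then show "\<bar>a e\<bar> \<le> (1 + sum b E) * norm (\<Sum>v\<in>E. a v *\<^sub>R v)"
      by (rule order_trans[OF b[OF e] mult_right_mono[OF _ norm_ge_zero]])
  qed
qed

lemma card_grid_subset_le:
  fixes A :: "('a \<Rightarrow> nat) set"
  assumes "finite E" and "A \<subseteq> extensional E"
    and close: "\<And>x x' e. \<lbrakk>x \<in> A; x' \<in> A; e \<in> E\<rbrakk> \<Longrightarrow> \<bar>real (x e) - real (x' e)\<bar> \<le> real K"
  shows "card A \<le> (2 * K + 1) ^ card E"
proof (cases "A = {}")
  case False
  then obtain z where z: "z \<in> A" by blast
  let ?box = "PiE E (\<lambda>e. {z e - K..z e + K})"
  have "A \<subseteq> ?box"
  proof
    fix x assume x: "x \<in> A"
    have "x e \<in> {z e - K..z e + K}" if "e \<in> E" for e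
      using close[OF x z that] by auto
    with x assms(2) show "x \<in> ?box"
      by (auto simp: PiE_def)
  qed
  then have "card A \<le> card ?box"
    using \<open>finite E\<close> by (intro card_mono finite_PiE) auto
  also have "\<dots> = (\<Prod>e\<in>E. card {z e - K..z e + K})"
    using \<open>finite E\<close> by (rule card_PiE)
  also have "\<dots> \<le> (\<Prod>e\<in>E. 2 * K + 1)"
    by (intro prod_mono) auto
  finally show ?thesis by simp
qed simp

section \<open>Covering approximate progressions\<close>

text \<open>A bounded set is totally bounded, so the minimum defining its covering number is attained.\<close>

lemma covering_number_attained:
  fixes S :: "(real ^ 'd) set"
  assumes "bounded S" and "r > 0"
  obtains \<U> where "finite \<U>" and "card \<U> = covering_number S r" and "S \<subseteq> \<Union>\<U>"
    and "\<And>U. U \<in> \<U> \<Longrightarrow> bounded U \<and> diameter U \<le> r"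
proof -
  let ?cover = "\<lambda>n. \<exists>\<U>. finite \<U> \<and> card \<U> = n \<and> S \<subseteq> \<Union>\<U> \<and>
    (\<forall>U\<in>\<U>. open U \<and> bounded U \<and> diameter U \<le> r)"
  have "compact (closure S)"
    using assms by simp
  then obtain X where X: "finite X" "closure S \<subseteq> (\<Union>x\<in>X. ball x (r/2))"
    using \<open>r > 0\<close> seq_compact_imp_totally_bounded[of "closure S"]
    by (metis compact_imp_seq_compact half_gt_zero)
  have "?cover (card ((\<lambda>x. ball x (r/2)) ` X))"
    using X closure_subset[of S] \<open>r > 0\<close>
    by (intro exI[of _ "(\<lambda>x. ball x (r/2)) ` X"]) auto
  then have "?cover (covering_number S r)"
    unfolding covering_number_def by (rule LeastI)
  then show thesis
    using that by blast
qed

lemma approx_AP_selection: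
  fixes E Q :: "(real ^ 'd) set"
  assumes "approx_AP k \<epsilon> E Q" and "finite E" and "k > 0"
  obtains \<Delta> t y where "\<Delta> > 0"
    and "\<And>x. x \<in> E \<rightarrow>\<^sub>E {0..<k} \<Longrightarrow> y x \<in> Q"
    and "\<And>x. x \<in> E \<rightarrow>\<^sub>E {0..<k} \<Longrightarrow>
          norm (t + \<Delta> *\<^sub>R (\<Sum>e\<in>E. real (x e) *\<^sub>R e) - y x) \<le> \<epsilon> * \<Delta>"
proof -
  obtain P \<Delta> t where \<Delta>: "\<Delta> > 0"
    and P: "P = {t + \<Delta> *\<^sub>R (\<Sum>e\<in>E. real (x e) *\<^sub>R e) | x. \<forall>e\<in>E. x e \<in> {0..<k}}"
    and "finite Q" and "card Q = card P"
    and near: "\<And>p. p \<in> P \<Longrightarrow> (INF y\<in>Q. norm (p - y)) \<le> \<epsilon> * \<Delta>"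
    using assms(1) unfolding approx_AP_def arithmetic_patch_def by blast
  let ?G = "E \<rightarrow>\<^sub>E {0..<k}"
  let ?f = "\<lambda>x. t + \<Delta> *\<^sub>R (\<Sum>e\<in>E. real (x e) *\<^sub>R e)"
  have P_image: "P = ?f ` ?G"
  proof
    show "P \<subseteq> ?f ` ?G"
    proof
      fix p assume "p \<in> P"
      then obtain x where p: "p = ?f x" and x: "\<forall>e\<in>E. x e \<in> {0..<k}"
        using P by blast
      have "p = ?f (restrict x E)"
        unfolding p by (intro arg_cong2[where f = "(+)"] arg_cong2[where f = scaleR] sum.cong) auto
      moreover have "restrict x E \<in> ?G"
        using x by auto
      ultimately show "p \<in> ?f ` ?G" by blast
    qed
    show "?f ` ?G \<subseteq> P"
      unfolding P by (blast dest: PiE_mem)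
  qed
  \<comment> \<open>The infimum is a genuine minimum only for nonempty \<open>Q\<close>; this follows from the cardinality condition.\<close>
  have "finite P"
    unfolding P_image using \<open>finite E\<close> by (intro finite_imageI finite_PiE) auto
  moreover have "P \<noteq> {}"
    unfolding P_image using \<open>k > 0\<close> by (auto simp: PiE_eq_empty_iff)
  ultimately have "Q \<noteq> {}"
    using \<open>card Q = card P\<close> by auto
  have "\<exists>q\<in>Q. norm (?f x - q) \<le> \<epsilon> * \<Delta>" if "x \<in> ?G" for x
  proof -
    let ?D = "(\<lambda>q. norm (?f x - q)) ` Q"
    have "Inf ?D \<in> ?D"
      using \<open>finite Q\<close> \<open>Q \<noteq> {}\<close> by (subst cInf_eq_Min) (auto intro!: Min_in simp del: Min_in)
    moreover have "Inf ?D \<le> \<epsilon> * \<Delta>"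
      using near P_image that by blast
    ultimately show ?thesis by auto
  qed
  then have "\<forall>x\<in>?G. \<exists>q. q \<in> Q \<and> norm (?f x - q) \<le> \<epsilon> * \<Delta>"
    by blast
  from bchoice[OF this] obtain y where "\<forall>x\<in>?G. y x \<in> Q \<and> norm (?f x - y x) \<le> \<epsilon> * \<Delta>"
    by blast
  with \<Delta> show thesis
    using that by blast
qed

text \<open>The constants \<open>L\<close> and \<open>M\<close> depend on the orientation only, so that \<open>k\<close> may tend to infinity.\<close>

lemma covering_number_of_approx_AP:
  fixes E :: "(real ^ 'd) set"
  assumes "independent E"
  obtains L M :: real where "L > 1" and "M > 0"
    and "\<And>k \<epsilon> Q F. \<lbrakk>k > 0; \<epsilon> \<le> 1; approx_AP k \<epsilon> E Q; Q \<subseteq> F\<rbrakk> \<Longrightarrow>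
      \<exists>\<Delta>>0. \<exists>p\<in>F. real k ^ card E \<le>
        M * real (covering_number (cball p (\<Delta> * (L * real k)) \<inter> F) \<Delta>)"
proof -
  have fin: "finite E"
    using assms independent_imp_finite by blast
  obtain B where "B > 0"
    and coord: "\<And>a e. e \<in> E \<Longrightarrow> \<bar>a e\<bar> \<le> B * norm (\<Sum>v\<in>E. a v *\<^sub>R v)"
    using coordinates_bounded_by_norm[OF assms] by blast
  \<comment> \<open>The factor \<open>3\<close> is the diameter of a covering set plus an approximation error at each end, in units of \<open>\<Delta>\<close>.\<close>
  define K where "K = nat \<lceil>3 * B\<rceil>"
  define S where "S = (\<Sum>e\<in>E. norm e)"
  have S: "S \<ge> 0"
    unfolding S_def by (simp add: sum_nonneg)
  show thesis
  proof
    show "S + 2 > 1" using S by simp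
    show "real ((2 * K + 1) ^ card E) > 0" by simp
  next
    fix k \<epsilon> and Q F :: "(real ^ 'd) set"
    assume k: "k > 0" and "\<epsilon> \<le> 1" and AP: "approx_AP k \<epsilon> E Q" and "Q \<subseteq> F"
    let ?G = "E \<rightarrow>\<^sub>E {0..<k}"
    obtain \<Delta> t y where \<Delta>: "\<Delta> > 0" and yQ: "\<And>x. x \<in> ?G \<Longrightarrow> y x \<in> Q"
      and y': "\<And>x. x \<in> ?G \<Longrightarrow>
        norm (t + \<Delta> *\<^sub>R (\<Sum>e\<in>E. real (x e) *\<^sub>R e) - y x) \<le> \<epsilon> * \<Delta>"
      by (rule approx_AP_selection[OF AP fin k]) (rule that)
    define f where "f x = t + \<Delta> *\<^sub>R (\<Sum>e\<in>E. real (x e) *\<^sub>R e)" for x :: "real ^ 'd \<Rightarrow> nat"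
    have "\<epsilon> * \<Delta> \<le> \<Delta>"
      using \<open>\<epsilon> \<le> 1\<close> \<Delta> by simp
    then have y: "norm (f x - y x) \<le> \<Delta>" if "x \<in> ?G" for x
      unfolding f_def using y'[OF that] by linarith
    have f_diff: "f x - f x' = \<Delta> *\<^sub>R (\<Sum>e\<in>E. (real (x e) - real (x' e)) *\<^sub>R e)" for x x'
      by (simp add: f_def scaleR_left_diff_distrib sum_subtractf scaleR_right_diff_distrib)
    define x0 where "x0 = (\<lambda>e\<in>E. 0 :: nat)"
    have x0: "x0 \<in> ?G"
      unfolding x0_def using k by auto
    define A where "A = cball (y x0) (\<Delta> * ((S + 2) * real k)) \<inter> F"
    have yA: "y x \<in> A" if x: "x \<in> ?G" for x
    proof -
      have "norm (\<Sum>e\<in>E. (real (x e) - real (x0 e)) *\<^sub>R e)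
          \<le> (\<Sum>e\<in>E. real k * norm e)"
        using x by (intro sum_norm_le) (auto simp: x0_def intro!: mult_right_mono dest!: PiE_mem)
      also have "\<dots> = S * real k"
        unfolding S_def sum_distrib_left[symmetric] by (rule mult.commute)
      finally have "norm (f x - f x0) \<le> \<Delta> * (S * real k)"
        using \<Delta> by (simp add: f_diff)
      moreover have "norm (y x0 - y x) \<le> norm (f x - f x0) + norm (f x0 - y x0) + norm (f x - y x)"
        by norm
      moreover have "\<Delta> \<le> \<Delta> * real k"
        using \<Delta> k by simp
      ultimately have "norm (y x0 - y x) \<le> \<Delta> * ((S + 2) * real k)"
        using y[OF x] y[OF x0] by (simp add: algebra_simps)
      with yQ[OF x] \<open>Q \<subseteq> F\<close> show ?thesis
        by (auto simp: A_def dist_norm)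
    qed
    have "bounded A"
      unfolding A_def by (simp add: bounded_Int)
    then obtain \<U> where \<U>: "finite \<U>" "card \<U> = covering_number A \<Delta>" "A \<subseteq> \<Union>\<U>"
      and diam: "\<And>U. U \<in> \<U> \<Longrightarrow> bounded U \<and> diameter U \<le> \<Delta>"
      using covering_number_attained \<Delta> by blast
    have multiplicity: "card {x \<in> ?G. y x \<in> U} \<le> (2 * K + 1) ^ card E" if U: "U \<in> \<U>" for U
    proof (rule card_grid_subset_le[OF fin])
      show "{x \<in> ?G. y x \<in> U} \<subseteq> extensional E"
        by (auto simp: PiE_def)
      fix x x' e assume x: "x \<in> {x \<in> ?G. y x \<in> U}" and x': "x' \<in> {x \<in> ?G. y x \<in> U}" and e: "e \<in> E"
      let ?v = "\<Sum>e\<in>E. (real (x e) - real (x' e)) *\<^sub>R e"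
      have "norm (y x - y x') \<le> \<Delta>"
        using diam[OF U] x x' diameter_bounded_bound[of U "y x" "y x'"] by (auto simp: dist_norm)
      moreover have "norm (f x - y x) \<le> \<Delta>" and "norm (f x' - y x') \<le> \<Delta>"
        using y x x' by auto
      moreover have "norm (f x - f x') \<le> norm (f x - y x) + norm (y x - y x') + norm (f x' - y x')"
        by norm
      moreover have "norm (f x - f x') = \<Delta> * norm ?v"
        using \<Delta> by (simp add: f_diff)
      ultimately have "\<Delta> * norm ?v \<le> \<Delta> * 3"
        by linarith
      then have "norm ?v \<le> 3"
        using \<Delta> by simp
      then have "B * norm ?v \<le> 3 * B"
        using \<open>B > 0\<close> by simp
      moreover have "3 * B \<le> real K"
        unfolding K_def by linarith
      ultimately show "\<bar>real (x e) - real (x' e)\<bar> \<le> real K"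
        using coord[OF e, of "\<lambda>e. real (x e) - real (x' e)"] by linarith
    qed
    have "?G \<subseteq> (\<Union>U\<in>\<U>. {x \<in> ?G. y x \<in> U})"
      using yA \<U>(3) by blast
    then have "card ?G \<le> card (\<Union>U\<in>\<U>. {x \<in> ?G. y x \<in> U})"
      using \<U>(1) fin by (intro card_mono finite_UN_I) (auto intro!: finite_PiE)
    also have "\<dots> \<le> (\<Sum>U\<in>\<U>. card {x \<in> ?G. y x \<in> U})"
      using \<U>(1) by (rule card_UN_le)
    also have "\<dots> \<le> card \<U> * (2 * K + 1) ^ card E"
      using sum_bounded_above[of \<U>, OF multiplicity] by simp
    finally have "k ^ card E \<le> (2 * K + 1) ^ card E * covering_number A \<Delta>"
      using fin by (simp add: card_PiE \<U>(2) mult.commute)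
    then have "real k ^ card E \<le> real ((2 * K + 1) ^ card E) * real (covering_number A \<Delta>)"
      by (metis of_nat_le_iff of_nat_mult of_nat_power)
    then show "\<exists>\<Delta>>0. \<exists>p\<in>F. real k ^ card E \<le> real ((2 * K + 1) ^ card E) *
        real (covering_number (cball p (\<Delta> * ((S + 2) * real k)) \<inter> F) \<Delta>)"
      using \<Delta> yQ[OF x0] \<open>Q \<subseteq> F\<close> unfolding A_def by blast
  qed
qed

section \<open>Comparison of growth exponents\<close>

lemma powr_exponent_le_of_bound:
  fixes a b D :: real
  assumes "\<And>k::nat. k \<ge> n \<Longrightarrow> real k powr a \<le> D * real k powr b"
  shows "a \<le> b"
proof (rule ccontr)
  assume "\<not> a \<le> b"
  then have ab: "a - b > 0" by simp
  obtain k0 :: nat where k0: "max D 1 powr (1 / (a - b)) < real k0"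
    using reals_Archimedean2 by blast
  define k where "k = max k0 (max n 1)"
  have k: "max D 1 powr (1 / (a - b)) < real k"
    using k0 by (simp add: k_def)
  have "D \<le> (max D 1 powr (1 / (a - b))) powr (a - b)"
    using ab by (simp add: powr_powr)
  also have "\<dots> < real k powr (a - b)"
    using k ab by (intro powr_less_mono2) auto
  finally have "D * real k powr b < real k powr (a - b) * real k powr b"
    by (intro mult_strict_right_mono) (auto simp: k_def)
  also have "\<dots> = real k powr a"
    by (simp flip: powr_add)
  also have "\<dots> \<le> D * real k powr b"
    by (rule assms) (simp add: k_def)
  finally show False by simp
qed

theorem theorem2p2:
  fixes E F :: "(real ^ 'd) set" and m :: nat and \<epsilon> :: real
  assumes "1 \<le> m" and "m \<le> CARD('d)"
    and "independent E" and "card E = m"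
    and "0 \<le> \<epsilon>" and "\<epsilon> < 1" and "\<epsilon> < min_subset_sum_norm E / 2"
    and "\<And>k. k \<ge> 3 \<Longrightarrow> \<exists>Q. Q \<subseteq> F \<and> approx_AP k \<epsilon> E Q"
  shows "assouad_dim F \<ge> ereal (real m)"
  unfolding assouad_dim_def
proof (rule Inf_greatest, clarsimp)
  fix \<sigma> C :: real
  assume "C > 0" and C: "\<forall>R>0. \<forall>r\<in>{0<..<R}. \<forall>x\<in>F.
    real (covering_number (cball x R \<inter> F) r) \<le> C * (R / r) powr \<sigma>"
  obtain L M where L: "L > 1" and M: "M > 0"
    and count: "\<And>k \<epsilon> Q F. \<lbrakk>k > 0; \<epsilon> \<le> 1; approx_AP k \<epsilon> E Q; Q \<subseteq> F\<rbrakk> \<Longrightarrow>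
      \<exists>\<Delta>>0. \<exists>p\<in>F. real k ^ card E \<le>
        M * real (covering_number (cball p (\<Delta> * (L * real k)) \<inter> F) \<Delta>)"
    using covering_number_of_approx_AP[OF \<open>independent E\<close>] by blast
  show "real m \<le> \<sigma>"
  proof (rule powr_exponent_le_of_bound)
    fix k :: nat assume k: "k \<ge> 3"
    obtain Q where "Q \<subseteq> F" "approx_AP k \<epsilon> E Q"
      using assms(8) k by blast
    then obtain \<Delta> p where \<Delta>: "\<Delta> > 0" and p: "p \<in> F" and
      lower: "real k ^ card E \<le> M * real (covering_number (cball p (\<Delta> * (L * real k)) \<inter> F) \<Delta>)"
      using count[of k \<epsilon> Q F] k \<open>\<epsilon> < 1\<close> by auto
    have "1 * 1 < L * real k"
      using L k by (intro mult_strict_mono) auto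
    then have "\<Delta> < \<Delta> * (L * real k)"
      using \<Delta> by simp
    then have "\<Delta> * (L * real k) > 0" and "\<Delta> \<in> {0<..<\<Delta> * (L * real k)}"
      using \<Delta> by auto
    then have "real (covering_number (cball p (\<Delta> * (L * real k)) \<inter> F) \<Delta>)
        \<le> C * (\<Delta> * (L * real k) / \<Delta>) powr \<sigma>"
      using C p by blast
    also have "\<dots> = C * L powr \<sigma> * real k powr \<sigma>"
      using \<Delta> L by (simp add: powr_mult)
    finally have "real k ^ card E \<le> M * (C * L powr \<sigma> * real k powr \<sigma>)"
      using lower M by (meson less_imp_le mult_left_mono order_trans)
    then show "real k powr real m \<le> (M * C * L powr \<sigma>) * real k powr \<sigma>"
      using k \<open>card E = m\<close> by (simp add: powr_realpow mult.assoc)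
  qed
qed

end
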